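(* Let $X$ be a nonempty set and $>$ a strict partial order on $X$ that has a utility representation. Let $P\subseteq X$, let $>_P$ be the restriction of $>$ to $P$, and let $f_P:P\to\mathbb{R}$ be a utility representation of $>_P$. Then $f_P$ is monotonically extendible to $X$ if and only if $f_P$ is separably increasing. Moreover, if $f_P$ is separably increasing, $u_1:X\to\mathbb{R}$ is a utility representation of $>$ satisfying $0<u_1(\mathbf{x})<1$ for all $\mathbf{x}\in X$, and $\alpha,\beta\in\mathbb{R}$ satisfy $\alpha<\beta$, then the function $f:X\to\mathbb{R}$, $$f(\mathbf{x})=\max\big\{a(\mathbf{x}),\,\min\{b(\mathbf{x}),\beta\}-\beta+\alpha\big\}\,\big(1-u_1(\mathbf{x})\big)+\min\big\{b(\mathbf{x}),\,\max\{a(\mathbf{x}),\alpha\}-\alpha+\beta\big\}\,u_1(\mathbf{x}),$$ is a monotone extension of $f_P$ to $X$.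
   Context: A strict partial order is a transitive irreflexive relation. $\mathbf{x}\ge\mathbf{y}$ means $\mathbf{x}>\mathbf{y}$ or $\mathbf{x}=\mathbf{y}$; $\mathbf{x}\le\mathbf{y}$ means $\mathbf{y}\ge\mathbf{x}$. A utility representation of a strict partial order $\succ$ on a set $Y$ is a function $u:Y\to\mathbb{R}$ such that for all $\mathbf{x},\mathbf{y}\in Y$: $\mathbf{x}\succ\mathbf{y}$ implies $u(\mathbf{x})>u(\mathbf{y})$, and $\mathbf{x}\approx\mathbf{y}$ implies $u(\mathbf{x})=u(\mathbf{y})$. Here $\mathbf{x}\sim\mathbf{y}$ means neither $\mathbf{x}\succ\mathbf{y}$ nor $\mathbf{y}\succ\mathbf{x}$, and $\mathbf{x}\approx\mathbf{y}$ means that for all $\mathbf{z}\in Y$, $\mathbf{x}\sim\mathbf{z}\Leftrightarrow\mathbf{y}\sim\mathbf{z}$. (For $>_P$ these relations are taken in $Y=P$.) A monotone extension of $f_P$ to $X$ is a function $f:X\to\mathbb{R}$ whose restriction to $P$ is $f_P$ and which is strictly increasing with respect to $>$: for all $\mathbf{x},\mathbf{y}\in X$, $\mathbf{x}>\mathbf{y}$ implies $f(\mathbf{x})>f(\mathbf{y})$. $f_P$ is monotonically extendible to $X$ if a monotone extension exists. Let $\widetilde X=X\cup\{-\infty,+\infty\}$ (two new points), with $>$ extended to $\widetilde X$ by $+\infty>-\infty$ and $+\infty>\mathbf{x}>-\infty$ for every $\mathbf{x}\in X$. The extended reals $\mathbb{R}\cup\{-\infty,+\infty\}$ carry the usual order,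 with $\sup\emptyset=-\infty$, $\inf\emptyset=+\infty$, and for finite $c$, $\pm\infty+c=\pm\infty$. For $\mathbf{x}\in\widetilde X$ define, with extended real values, $$a(\mathbf{x})=\sup\{f_P(\mathbf{y})\mid \mathbf{y}\le\mathbf{x},\ \mathbf{y}\in P\},\qquad b(\mathbf{x})=\inf\{f_P(\mathbf{z})\mid \mathbf{z}\ge\mathbf{x},\ \mathbf{z}\in P\}.$$ $f_P$ is separably increasing if for all $\mathbf{x},\mathbf{x}'\in\widetilde X$, $\mathbf{x}'>\mathbf{x}$ implies $b(\mathbf{x}')>a(\mathbf{x})$. (In that case the max and min factors in the formula for $f$ are finite, so $f$ is well defined.) *)

theory Defs
  imports "HOL-Library.Extended" "HOL-Library.Extended_Real"
begin

no_notation Pinf ("\<infinity>") and Minf ("-\<infinity>")  (* keep \<infinity> unambiguous for ereal *)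

text \<open>
  A relation \<^term>\<open>gt :: 'a \<Rightarrow> 'a \<Rightarrow> bool\<close> is read as \<^term>\<open>gt x y\<close> iff \<open>x\<close> is above \<open>y\<close>.  Only its
  values on an explicit carrier matter, so the same \<^term>\<open>gt\<close> serves, with carrier \<open>P\<close>, as its
  restriction to \<open>P\<close>.
\<close>

definition strict_partial_order_on :: "'a set \<Rightarrow> ('a \<Rightarrow> 'a \<Rightarrow> bool) \<Rightarrow> bool" where
  "strict_partial_order_on Y gt \<longleftrightarrow> irreflp_on Y gt \<and> transp_on Y gt"

definition incomparable :: "('a \<Rightarrow> 'a \<Rightarrow> bool) \<Rightarrow> 'a \<Rightarrow> 'a \<Rightarrow> bool" where
  "incomparable gt x y \<longleftrightarrow> \<not> gt x y \<and> \<not> gt y x"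

definition indistinguishable_on :: "'a set \<Rightarrow> ('a \<Rightarrow> 'a \<Rightarrow> bool) \<Rightarrow> 'a \<Rightarrow> 'a \<Rightarrow> bool" where
  "indistinguishable_on Y gt x y \<longleftrightarrow>
     (\<forall>z\<in>Y. incomparable gt x z \<longleftrightarrow> incomparable gt y z)"

definition utility_representation ::
    "'a set \<Rightarrow> ('a \<Rightarrow> 'a \<Rightarrow> bool) \<Rightarrow> ('a \<Rightarrow> real) \<Rightarrow> bool" where
  "utility_representation Y gt u \<longleftrightarrow>
     (\<forall>x\<in>Y. \<forall>y\<in>Y. (gt x y \<longrightarrow> u x > u y) \<and>
                    (indistinguishable_on Y gt x y \<longrightarrow> u x = u y))"

definition monotone_extension ::
    "'a set \<Rightarrow> ('a \<Rightarrow> 'a \<Rightarrow> bool) \<Rightarrow> 'a set \<Rightarrow> ('a \<Rightarrow> real) \<Rightarrow> ('a \<Rightarrow> real) \<Rightarrow> bool" where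
  "monotone_extension X gt P f\<^sub>P f \<longleftrightarrow> (\<forall>x\<in>P. f x = f\<^sub>P x) \<and> monotone_on X gt (>) f"

definition monotonically_extendible ::
    "'a set \<Rightarrow> ('a \<Rightarrow> 'a \<Rightarrow> bool) \<Rightarrow> 'a set \<Rightarrow> ('a \<Rightarrow> real) \<Rightarrow> bool" where
  "monotonically_extendible X gt P f\<^sub>P \<longleftrightarrow> (\<exists>f. monotone_extension X gt P f\<^sub>P f)"

text \<open>
  \<^typ>\<open>'a extended\<close> is used only as a datatype adding two points to \<^typ>\<open>'a\<close>; its order relation is
  defined here from \<^term>\<open>gt\<close> and is unrelated to the type class order on \<^typ>\<open>'a extended\<close>.
\<close>

definition extended_carrier :: "'a set \<Rightarrow> 'a extended set" where
  "extended_carrier X = Fin ` X \<union> {Minf, Pinf}"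

fun extended_gt :: "('a \<Rightarrow> 'a \<Rightarrow> bool) \<Rightarrow> 'a extended \<Rightarrow> 'a extended \<Rightarrow> bool" where
  "extended_gt gt (Fin x) (Fin y) \<longleftrightarrow> gt x y"
| "extended_gt gt (Fin x) Minf \<longleftrightarrow> True"
| "extended_gt gt (Fin x) Pinf \<longleftrightarrow> False"
| "extended_gt gt Pinf y \<longleftrightarrow> y \<noteq> Pinf"
| "extended_gt gt Minf y \<longleftrightarrow> False"

definition extended_ge :: "('a \<Rightarrow> 'a \<Rightarrow> bool) \<Rightarrow> 'a extended \<Rightarrow> 'a extended \<Rightarrow> bool" where
  "extended_ge gt x y \<longleftrightarrow> extended_gt gt x y \<or> x = y"

definition lower_bound_fun ::
    "('a \<Rightarrow> 'a \<Rightarrow> bool) \<Rightarrow> 'a set \<Rightarrow> ('a \<Rightarrow> real) \<Rightarrow> 'a extended \<Rightarrow> ereal" where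
  "lower_bound_fun gt P f\<^sub>P x = Sup {ereal (f\<^sub>P y) | y. y \<in> P \<and> extended_ge gt x (Fin y)}"

definition upper_bound_fun ::
    "('a \<Rightarrow> 'a \<Rightarrow> bool) \<Rightarrow> 'a set \<Rightarrow> ('a \<Rightarrow> real) \<Rightarrow> 'a extended \<Rightarrow> ereal" where
  "upper_bound_fun gt P f\<^sub>P x = Inf {ereal (f\<^sub>P z) | z. z \<in> P \<and> extended_ge gt (Fin z) x}"

definition separably_increasing ::
    "'a set \<Rightarrow> ('a \<Rightarrow> 'a \<Rightarrow> bool) \<Rightarrow> 'a set \<Rightarrow> ('a \<Rightarrow> real) \<Rightarrow> bool" where
  "separably_increasing X gt P f\<^sub>P \<longleftrightarrow>
     (\<forall>x\<in>extended_carrier X. \<forall>x'\<in>extended_carrier X.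
        extended_gt gt x' x \<longrightarrow> upper_bound_fun gt P f\<^sub>P x' > lower_bound_fun gt P f\<^sub>P x)"

text \<open>
  When \<open>0 < u x < 1\<close>, the formula below is finite iff both the max and the min factor are: in
  \<^typ>\<open>ereal\<close>, an infinite factor times a positive real stays infinite, and a sum with an infinite
  summand is infinite.
\<close>

definition extension_formula ::
    "('a \<Rightarrow> 'a \<Rightarrow> bool) \<Rightarrow> 'a set \<Rightarrow> ('a \<Rightarrow> real) \<Rightarrow> ('a \<Rightarrow> real) \<Rightarrow> real \<Rightarrow> real \<Rightarrow> 'a \<Rightarrow> ereal" where
  "extension_formula gt P f\<^sub>P u \<alpha> \<beta> x =
     (let a = lower_bound_fun gt P f\<^sub>P (Fin x);
          b = upper_bound_fun gt P f\<^sub>P (Fin x)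
      in max a (min b (ereal \<beta>) - ereal \<beta> + ereal \<alpha>) * ereal (1 - u x)
         + min b (max a (ereal \<alpha>) - ereal \<alpha> + ereal \<beta>) * ereal (u x))"

end

theory Submission
  imports Defs
begin

text \<open>
  Write \<open>a\<close> and \<open>b\<close> for the lower and upper bound functions of \<open>f\<^sub>P\<close>.  Every monotone extension
  \<open>f\<close> is squeezed, \<open>a \<le> f \<le> b\<close>, so \<open>x' > x\<close> gives \<open>b x' \<ge> f x' > f x \<ge> a x\<close>; the two added points
  say that \<open>a\<close> never reaches \<open>+\<infinity>\<close> and \<open>b\<close> never reaches \<open>-\<infinity>\<close>.  Hence extendibility forces
  separable increase.

  Conversely the formula interpolates with weight \<open>u\<^sub>1\<close> between two finite weakly increasing
  functions \<open>L \<le> U\<close> lying in \<open>[a, b]\<close>.  An interpolation of this kind is strictly increasing because \<open>u\<^sub>1\<close> is,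
  unless between some \<open>x' > x\<close> neither \<open>L\<close> nor \<open>U\<close> grows and the gap \<open>[L, U]\<close> is degenerate.
  The truncations with \<open>\<alpha> < \<beta>\<close> are arranged so that \<open>L = U\<close> only where \<open>a = b\<close>, and then \<open>L = U\<close>
  is that common value.  The exceptional case would thus give \<open>b x' = a x\<close>, which is what separable
  increase excludes.  On \<open>P\<close> both bounds equal \<open>f\<^sub>P\<close>, so the interpolation does too.
  A weight \<open>u\<^sub>1\<close> with values in \<open>(0, 1)\<close> comes from any utility representation by squashing the
  real line.
\<close>

section \<open>The bound functions\<close>

lemma lower_bound_fun_mono:
  assumes "strict_partial_order_on X gt" "P \<subseteq> X" "x \<in> X" "x' \<in> X" "gt x' x"
  shows "lower_bound_fun gt P f (Fin x) \<le> lower_bound_fun gt P f (Fin x')"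
proof -
  have tr: "transp_on X gt"
    using assms(1) by (simp add: strict_partial_order_on_def)
  have "extended_ge gt (Fin x') (Fin y)" if "y \<in> P" "extended_ge gt (Fin x) (Fin y)" for y
    using that assms transp_onD[OF tr, of x' x y] by (auto simp: extended_ge_def)
  then show ?thesis
    unfolding lower_bound_fun_def by (intro Sup_subset_mono) auto
qed

lemma upper_bound_fun_mono:
  assumes "strict_partial_order_on X gt" "P \<subseteq> X" "x \<in> X" "x' \<in> X" "gt x' x"
  shows "upper_bound_fun gt P f (Fin x) \<le> upper_bound_fun gt P f (Fin x')"
proof -
  have tr: "transp_on X gt"
    using assms(1) by (simp add: strict_partial_order_on_def)
  have "extended_ge gt (Fin z) (Fin x)" if "z \<in> P" "extended_ge gt (Fin z) (Fin x')" for z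
    using that assms transp_onD[OF tr, of z x' x] by (auto simp: extended_ge_def)
  then show ?thesis
    unfolding upper_bound_fun_def by (intro Inf_superset_mono) auto
qed

lemma lower_bound_fun_le_upper_bound_fun:
  assumes "strict_partial_order_on X gt" "P \<subseteq> X" "utility_representation P gt f" "x \<in> X"
  shows "lower_bound_fun gt P f (Fin x) \<le> upper_bound_fun gt P f (Fin x)"
proof -
  have tr: "transp_on X gt"
    using assms(1) by (simp add: strict_partial_order_on_def)
  have "f y \<le> f z"
    if "y \<in> P" "extended_ge gt (Fin x) (Fin y)" "z \<in> P" "extended_ge gt (Fin z) (Fin x)" for y z
  proof -
    have "gt z y \<or> z = y"
      using that assms(2,4) transp_onD[OF tr, of z x y] by (auto simp: extended_ge_def)
    then show ?thesis
      using that assms(3) by (fastforce simp: utility_representation_def)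
  qed
  then show ?thesis
    unfolding lower_bound_fun_def upper_bound_fun_def
    by (intro Sup_least Inf_greatest) auto
qed

lemma bound_funs_on_base:
  assumes "strict_partial_order_on X gt" "P \<subseteq> X" "utility_representation P gt f" "x \<in> P"
  shows "lower_bound_fun gt P f (Fin x) = ereal (f x)"
    and "upper_bound_fun gt P f (Fin x) = ereal (f x)"
proof -
  have "ereal (f x) \<le> lower_bound_fun gt P f (Fin x)"
    unfolding lower_bound_fun_def
    using assms(4) by (intro Sup_upper) (auto simp: extended_ge_def)
  moreover have "upper_bound_fun gt P f (Fin x) \<le> ereal (f x)"
    unfolding upper_bound_fun_def
    using assms(4) by (intro Inf_lower) (auto simp: extended_ge_def)
  moreover have "lower_bound_fun gt P f (Fin x) \<le> upper_bound_fun gt P f (Fin x)"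
    using lower_bound_fun_le_upper_bound_fun[OF assms(1-3)] assms(2,4) by blast
  ultimately show "lower_bound_fun gt P f (Fin x) = ereal (f x)"
    and "upper_bound_fun gt P f (Fin x) = ereal (f x)" by auto
qed

section \<open>Necessity of separable increase\<close>

text \<open>
  These two values turn the comparisons of separable increase that involve an added point into
  \<open>a < \<infinity>\<close> and \<open>-\<infinity> < b\<close> on \<open>X\<close>.
\<close>

lemma upper_bound_fun_Pinf: "upper_bound_fun gt P f Pinf = \<infinity>"
  by (simp add: upper_bound_fun_def extended_ge_def top_ereal_def)

lemma lower_bound_fun_Minf: "lower_bound_fun gt P f Minf = -\<infinity>"
  by (simp add: lower_bound_fun_def extended_ge_def bot_ereal_def)

lemma bound_funs_squeeze_monotone_extension:
  assumes "monotone_extension X gt P fP f" "P \<subseteq> X" "x \<in> X"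
  shows "lower_bound_fun gt P fP (Fin x) \<le> ereal (f x)"
    and "ereal (f x) \<le> upper_bound_fun gt P fP (Fin x)"
proof -
  have eq: "f y = fP y" if "y \<in> P" for y
    using assms(1) that by (simp add: monotone_extension_def)
  have mono: "monotone_on X gt (>) f"
    using assms(1) by (simp add: monotone_extension_def)
  have le: "f q \<le> f p" if "p \<in> X" "q \<in> X" "extended_ge gt (Fin p) (Fin q)" for p q
    using that monotone_onD[OF mono, of p q] by (auto simp: extended_ge_def)
  show "lower_bound_fun gt P fP (Fin x) \<le> ereal (f x)"
    unfolding lower_bound_fun_def
    using le assms(2,3) by (intro Sup_least) (auto simp flip: eq)
  show "ereal (f x) \<le> upper_bound_fun gt P fP (Fin x)"
    unfolding upper_bound_fun_def
    using le assms(2,3) by (intro Inf_greatest) (auto simp flip: eq)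
qed

lemma monotonically_extendible_imp_separably_increasing:
  assumes "P \<subseteq> X" "monotonically_extendible X gt P fP"
  shows "separably_increasing X gt P fP"
proof -
  obtain f where f: "monotone_extension X gt P fP f"
    using assms(2) by (auto simp: monotonically_extendible_def)
  have mono: "monotone_on X gt (>) f"
    using f by (simp add: monotone_extension_def)
  note sq = bound_funs_squeeze_monotone_extension[OF f assms(1)]
  have fin: "lower_bound_fun gt P fP (Fin x) < upper_bound_fun gt P fP (Fin x')"
    if "x \<in> X" "x' \<in> X" "gt x' x" for x x'
  proof -
    have "ereal (f x) < ereal (f x')"
      using monotone_onD[OF mono, of x' x] that by simp
    then show ?thesis
      using sq(1)[OF that(1)] sq(2)[OF that(2)] by (meson le_less_trans less_le_trans)
  qed
  have "lower_bound_fun gt P fP (Fin x) < \<infinity>" "-\<infinity> < upper_bound_fun gt P fP (Fin x)"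
    if "x \<in> X" for x
    using sq[OF that] by auto
  with fin show ?thesis
    by (auto simp: separably_increasing_def extended_carrier_def
        upper_bound_fun_Pinf lower_bound_fun_Minf)
qed

section \<open>The truncated bounds\<close>

text \<open>
  The ends \<open>L\<close> and \<open>U\<close> of the interpolation are \<open>\<alpha>\<close> and \<open>\<beta>\<close> where \<open>[a, b]\<close> is the whole line.  If
  \<open>b\<close> falls below \<open>\<beta>\<close>, the candidate \<open>\<alpha>\<close> for \<open>L\<close> is lowered by the same amount, so that it stays
  strictly below \<open>b\<close>; it gives way to \<open>a\<close> only if \<open>a\<close> is larger.  The upper end is the mirror image.
\<close>

definition truncated_lower :: "real \<Rightarrow> real \<Rightarrow> ereal \<Rightarrow> ereal \<Rightarrow> ereal" where
  "truncated_lower \<alpha> \<beta> a b = max a (min b (ereal \<beta>) - ereal \<beta> + ereal \<alpha>)"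

definition truncated_upper :: "real \<Rightarrow> real \<Rightarrow> ereal \<Rightarrow> ereal \<Rightarrow> ereal" where
  "truncated_upper \<alpha> \<beta> a b = min b (max a (ereal \<alpha>) - ereal \<alpha> + ereal \<beta>)"

lemma truncated_lower_finite:
  assumes "a < \<infinity>" "-\<infinity> < b"
  shows "\<bar>truncated_lower \<alpha> \<beta> a b\<bar> \<noteq> \<infinity>"
  using assms unfolding truncated_lower_def
  by (cases a; cases b) (auto simp: min_def max_def)

lemma truncated_upper_finite:
  assumes "a < \<infinity>" "-\<infinity> < b"
  shows "\<bar>truncated_upper \<alpha> \<beta> a b\<bar> \<noteq> \<infinity>"
  using assms unfolding truncated_upper_def
  by (cases a; cases b) (auto simp: min_def max_def)

lemma truncated_lower_mono:
  assumes "a \<le> a'" "b \<le> b'"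
  shows "truncated_lower \<alpha> \<beta> a b \<le> truncated_lower \<alpha> \<beta> a' b'"
  unfolding truncated_lower_def using assms
  by (intro max.mono add_right_mono ereal_minus_mono min.mono) auto

lemma truncated_upper_mono:
  assumes "a \<le> a'" "b \<le> b'"
  shows "truncated_upper \<alpha> \<beta> a b \<le> truncated_upper \<alpha> \<beta> a' b'"
  unfolding truncated_upper_def using assms
  by (intro min.mono add_right_mono ereal_minus_mono max.mono) auto

lemma truncated_lower_le_upper:
  assumes "a \<le> b" "\<alpha> < \<beta>"
  shows "truncated_lower \<alpha> \<beta> a b \<le> truncated_upper \<alpha> \<beta> a b"
  using assms unfolding truncated_lower_def truncated_upper_def
  by (cases a; cases b) (auto simp: min_def max_def)

text \<open>
  Shifting by \<open>\<beta> - \<alpha> > 0\<close> makes the truncated entry of \<open>L\<close> strictly smaller than both entries of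
  \<open>U\<close>, and the truncated entry of \<open>U\<close> strictly larger than both entries of \<open>L\<close>, so the two can only
  meet at \<open>L = a\<close> and \<open>U = b\<close>.
\<close>

lemma truncated_lower_eq_upperD:
  assumes "\<alpha> < \<beta>" "a < \<infinity>" "-\<infinity> < b"
    and "truncated_lower \<alpha> \<beta> a b = truncated_upper \<alpha> \<beta> a b"
  shows "a = truncated_lower \<alpha> \<beta> a b" and "b = truncated_upper \<alpha> \<beta> a b"
  using assms unfolding truncated_lower_def truncated_upper_def
  by (cases a; cases b; simp flip: ereal_max ereal_min; linarith)+

lemma truncated_at_point:
  assumes "\<alpha> < \<beta>"
  shows "truncated_lower \<alpha> \<beta> (ereal c) (ereal c) = ereal c"
    and "truncated_upper \<alpha> \<beta> (ereal c) (ereal c) = ereal c"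
  using assms by (auto simp: truncated_lower_def truncated_upper_def min_def max_def)

section \<open>Interpolation\<close>

lemma interpolation_strict_mono:
  fixes L U L' U' w w' :: real
  assumes "L \<le> U" "L \<le> L'" "U \<le> U'" "w < w'" "0 < w'" "w' < 1"
    and "\<not> (L = U \<and> L = L' \<and> U = U')"
  shows "L * (1 - w) + U * w < L' * (1 - w') + U' * w'"
proof -
  \<comment> \<open>The increment splits into three nonnegative contributions, which vanish together only in the
    excluded case.\<close>
  have split: "L' * (1 - w') + U' * w' - (L * (1 - w) + U * w)
      = (L' - L) * (1 - w') + (U' - U) * w' + (U - L) * (w' - w)"
    by (simp add: algebra_simps)
  have nn: "0 \<le> (L' - L) * (1 - w')" "0 \<le> (U' - U) * w'" "0 \<le> (U - L) * (w' - w)"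
    using assms by auto
  consider "L < U" | "L < L'" | "U < U'" using assms by linarith
  then have "0 < (L' - L) * (1 - w') \<or> 0 < (U' - U) * w' \<or> 0 < (U - L) * (w' - w)"
    using assms by cases auto
  with split nn show ?thesis by linarith
qed

lemma separably_increasing_imp_monotone_extension:
  assumes po: "strict_partial_order_on X gt" and PX: "P \<subseteq> X"
    and fP: "utility_representation P gt fP" and si: "separably_increasing X gt P fP"
    and u: "utility_representation X gt u" and u01: "\<forall>x\<in>X. 0 < u x \<and> u x < 1"
    and ab: "\<alpha> < \<beta>"
  shows "(\<forall>x\<in>X. \<bar>extension_formula gt P fP u \<alpha> \<beta> x\<bar> \<noteq> \<infinity>) \<and>
    monotone_extension X gt P fP (\<lambda>x. real_of_ereal (extension_formula gt P fP u \<alpha> \<beta> x))"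
proof -
  define a where "a x = lower_bound_fun gt P fP (Fin x)" for x
  define b where "b x = upper_bound_fun gt P fP (Fin x)" for x
  define L where "L x = real_of_ereal (truncated_lower \<alpha> \<beta> (a x) (b x))" for x
  define U where "U x = real_of_ereal (truncated_upper \<alpha> \<beta> (a x) (b x))" for x

  have sep: "a x < b x'" if "x \<in> X" "x' \<in> X" "gt x' x" for x x'
    using si that by (simp add: separably_increasing_def extended_carrier_def a_def b_def)
  \<comment> \<open>Comparing with the two added points makes the one-sided bounds finite.\<close>
  have a_fin: "a x < \<infinity>" if "x \<in> X" for x
  proof -
    have "a x < upper_bound_fun gt P fP Pinf"
      using si that by (simp add: separably_increasing_def extended_carrier_def a_def)
    then show ?thesis by (simp add: upper_bound_fun_Pinf)
  qed
  have b_fin: "-\<infinity> < b x" if "x \<in> X" for x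
  proof -
    have "lower_bound_fun gt P fP Minf < b x"
      using si that by (simp add: separably_increasing_def extended_carrier_def b_def)
    then show ?thesis by (simp add: lower_bound_fun_Minf)
  qed
  have L: "truncated_lower \<alpha> \<beta> (a x) (b x) = ereal (L x)" if "x \<in> X" for x
    using truncated_lower_finite[OF a_fin[OF that] b_fin[OF that]]
    by (simp add: L_def ereal_real)
  have U: "truncated_upper \<alpha> \<beta> (a x) (b x) = ereal (U x)" if "x \<in> X" for x
    using truncated_upper_finite[OF a_fin[OF that] b_fin[OF that]]
    by (simp add: U_def ereal_real)
  have formula: "extension_formula gt P fP u \<alpha> \<beta> x = ereal (L x * (1 - u x) + U x * u x)"
    if "x \<in> X" for x
    using L[OF that] U[OF that]
    by (simp add: extension_formula_def Let_def truncated_lower_def truncated_upper_def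
        a_def b_def)

  have LU: "L x \<le> U x" if "x \<in> X" for x
    using truncated_lower_le_upper[OF lower_bound_fun_le_upper_bound_fun[OF po PX fP that] ab] L[OF that] U[OF that]
    by (simp add: a_def b_def)
  have meet: "a x = ereal (L x)" "b x = ereal (U x)" if "x \<in> X" "L x = U x" for x
    using truncated_lower_eq_upperD[OF ab a_fin[OF that(1)] b_fin[OF that(1)]]
      L[OF that(1)] U[OF that(1)] that(2)
    by simp_all

  have incr: "L x * (1 - u x) + U x * u x < L x' * (1 - u x') + U x' * u x'"
    if x: "x \<in> X" and x': "x' \<in> X" and gt: "gt x' x" for x x'
  proof (rule interpolation_strict_mono)
    have le: "a x \<le> a x'" "b x \<le> b x'"
      using lower_bound_fun_mono[OF po PX x x' gt] upper_bound_fun_mono[OF po PX x x' gt]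
      by (simp_all add: a_def b_def)
    show "L x \<le> U x" by (rule LU[OF x])
    show "L x \<le> L x'" using truncated_lower_mono[OF le, of \<alpha> \<beta>] L x x' by simp
    show "U x \<le> U x'" using truncated_upper_mono[OF le, of \<alpha> \<beta>] U x x' by simp
    show "u x < u x'" using u x x' gt by (simp add: utility_representation_def)
    show "0 < u x'" "u x' < 1" using u01 x' by auto
    show "\<not> (L x = U x \<and> L x = L x' \<and> U x = U x')"
    proof
      assume eq: "L x = U x \<and> L x = L x' \<and> U x = U x'"
      then have "a x = b x'" using meet(1)[OF x] meet(2)[OF x'] by simp
      with sep[OF x x' gt] show False by simp
    qed
  qed
  have base: "L x * (1 - u x) + U x * u x = fP x" if "x \<in> P" for x
    using bound_funs_on_base[OF po PX fP that] truncated_at_point[OF ab, of "fP x"]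
    by (simp add: L_def U_def a_def b_def algebra_simps)

  have "monotone_extension X gt P fP
      (\<lambda>x. real_of_ereal (extension_formula gt P fP u \<alpha> \<beta> x))"
    unfolding monotone_extension_def
  proof (intro conjI ballI monotone_onI)
    fix x assume "x \<in> P"
    then show "real_of_ereal (extension_formula gt P fP u \<alpha> \<beta> x) = fP x"
      using PX formula base by auto
  next
    fix x y assume "x \<in> X" "y \<in> X" "gt x y"
    then show "real_of_ereal (extension_formula gt P fP u \<alpha> \<beta> x)
        > real_of_ereal (extension_formula gt P fP u \<alpha> \<beta> y)"
      using incr[of y x] formula by simp
  qed
  then show ?thesis using formula by simp
qed

lemma utility_representation_in_unit_interval:
  assumes "utility_representation X gt u"
  obtains v where "utility_representation X gt v" "\<forall>x\<in>X. 0 < v x \<and> v x < 1"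
proof
  let ?v = "\<lambda>x. arctan (u x) / pi + 1 / 2"
  show "utility_representation X gt ?v"
    using assms by (simp add: utility_representation_def divide_strict_right_mono arctan_less_iff)
  show "\<forall>x\<in>X. 0 < ?v x \<and> ?v x < 1"
  proof
    fix x
    show "0 < ?v x \<and> ?v x < 1"
      using arctan_lbound[of "u x"] arctan_ubound[of "u x"] pi_gt_zero
      by (simp add: field_simps)
  qed
qed

theorem theorem14:
  fixes X P :: "'a set" and gt :: "'a \<Rightarrow> 'a \<Rightarrow> bool" and f\<^sub>P :: "'a \<Rightarrow> real"
  assumes "X \<noteq> {}"
    and "strict_partial_order_on X gt"
    and "\<exists>u. utility_representation X gt u"
    and "P \<subseteq> X"
    and "utility_representation P gt f\<^sub>P"
  shows "(monotonically_extendible X gt P f\<^sub>P \<longleftrightarrow> separably_increasing X gt P f\<^sub>P) \<and>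
    (separably_increasing X gt P f\<^sub>P \<longrightarrow>
      (\<forall>u\<^sub>1 \<alpha> \<beta>.
         utility_representation X gt u\<^sub>1 \<and> (\<forall>x\<in>X. 0 < u\<^sub>1 x \<and> u\<^sub>1 x < 1) \<and> \<alpha> < \<beta> \<longrightarrow>
           (\<forall>x\<in>X. \<bar>extension_formula gt P f\<^sub>P u\<^sub>1 \<alpha> \<beta> x\<bar> \<noteq> \<infinity>) \<and>
           monotone_extension X gt P f\<^sub>P
             (\<lambda>x. real_of_ereal (extension_formula gt P f\<^sub>P u\<^sub>1 \<alpha> \<beta> x))))"
proof -
  have extends: "(\<forall>x\<in>X. \<bar>extension_formula gt P f\<^sub>P u \<alpha> \<beta> x\<bar> \<noteq> \<infinity>) \<and>
      monotone_extension X gt P f\<^sub>P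
        (\<lambda>x. real_of_ereal (extension_formula gt P f\<^sub>P u \<alpha> \<beta> x))"
    if "separably_increasing X gt P f\<^sub>P" "utility_representation X gt u"
      "\<forall>x\<in>X. 0 < u x \<and> u x < 1" "\<alpha> < \<beta>" for u \<alpha> \<beta>
    using assms(2,4,5) that by (rule separably_increasing_imp_monotone_extension)
  have "monotonically_extendible X gt P f\<^sub>P" if si: "separably_increasing X gt P f\<^sub>P"
  proof -
    obtain u where "utility_representation X gt u"
      using assms(3) by blast
    then obtain v where v: "utility_representation X gt v" "\<forall>x\<in>X. 0 < v x \<and> v x < 1"
      by (rule utility_representation_in_unit_interval)
    show ?thesis
      using extends[OF si v, of 0 1] by (auto simp: monotonically_extendible_def)
  qed
  moreover have "separably_increasing X gt P f\<^sub>P" if "monotonically_extendible X gt P f\<^sub>P"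
    using assms(4) that by (rule monotonically_extendible_imp_separably_increasing)
  ultimately have "monotonically_extendible X gt P f\<^sub>P \<longleftrightarrow> separably_increasing X gt P f\<^sub>P"
    by (rule iffI[rotated])
  then show ?thesis
    using extends by (intro conjI impI allI) simp_all
qed

end
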